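(* Let $\mathbf{k}$ be a unitary commutative ring, $\Omega$ a nonempty set, and let $(R,\{\prec_\omega,\succ_\omega\mid\omega\in\Omega\})$ be a matching dendriform algebra. Define $$x\ast_\omega y:=x\succ_\omega y-y\prec_\omega x,\qquad x,y\in R,\ \omega\in\Omega .$$ Then $(R,\{\ast_\omega\mid\omega\in\Omega\})$ is a matching pre-Lie algebra.
   Context: All modules are over $\mathbf{k}$ and all binary operations are $\mathbf{k}$-bilinear. A matching dendriform algebra is a module $D$ with binary operations $\{\prec_\omega,\succ_\omega\mid\omega\in\Omega\}$ such that for all $x,y,z\in D$ and $\alpha,\beta\in\Omega$: $$(x\prec_\alpha y)\prec_\beta z=x\prec_\alpha(y\prec_\beta z)+x\prec_\beta(y\succ_\alpha z),$$ $$(x\succ_\alpha y)\prec_\beta z=x\succ_\alpha(y\prec_\beta z),$$ $$(x\prec_\beta y)\succ_\alpha z+(x\succ_\alpha y)\succ_\beta z=x\succ_\alpha(y\succ_\beta z).$$ A matching (left) pre-Lie algebra (also called multiple pre-Lie algebra) is a module $A$ with binary operations $\{\ast_\omega\mid\omega\in\Omega\}$ such that $$x\ast_\alpha(y\ast_\beta z)-(x\ast_\alpha y)\ast_\beta z=y\ast_\beta(x\ast_\alpha z)-(y\ast_\beta x)\ast_\alpha z\quad\text{for all }x,y,z\in A,\ \alpha,\beta\in\Omega .$$ *)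

theory Defs
  imports "HOL-Algebra.Module"
begin

definition bilinear_operation ::
    "('k, 'r) ring_scheme \<Rightarrow> ('k, 'm, 'd) module_scheme \<Rightarrow> ('m \<Rightarrow> 'm \<Rightarrow> 'm) \<Rightarrow> bool"
  where
  "bilinear_operation K M f \<longleftrightarrow>
     f \<in> carrier M \<rightarrow> carrier M \<rightarrow> carrier M \<and>
     (\<forall>x\<in>carrier M. \<forall>y\<in>carrier M. \<forall>z\<in>carrier M.
        f (x \<oplus>\<^bsub>M\<^esub> y) z = f x z \<oplus>\<^bsub>M\<^esub> f y z \<and>
        f x (y \<oplus>\<^bsub>M\<^esub> z) = f x y \<oplus>\<^bsub>M\<^esub> f x z) \<and>
     (\<forall>c\<in>carrier K. \<forall>x\<in>carrier M. \<forall>y\<in>carrier M.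
        f (c \<odot>\<^bsub>M\<^esub> x) y = c \<odot>\<^bsub>M\<^esub> f x y \<and>
        f x (c \<odot>\<^bsub>M\<^esub> y) = c \<odot>\<^bsub>M\<^esub> f x y)"

text \<open>
  A family of operations takes its index first: \<open>prec \<alpha> x y\<close> is
  \<open>x \<prec>\<^sub>\<alpha> y\<close>, and likewise for \<open>succ\<close> and \<open>star\<close>.  The locale \<open>module\<close> requires
  \<open>K\<close> to be a commutative unital ring (possibly the zero ring).
\<close>

locale matching_dendriform_algebra = module K D
  for K :: "('k, 'r) ring_scheme" and D :: "('k, 'm, 'd) module_scheme" +
  fixes \<Omega> :: "'w set"
    and prec :: "'w \<Rightarrow> 'm \<Rightarrow> 'm \<Rightarrow> 'm"
    and succ :: "'w \<Rightarrow> 'm \<Rightarrow> 'm \<Rightarrow> 'm"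
  assumes prec_bilinear: "\<alpha> \<in> \<Omega> \<Longrightarrow> bilinear_operation K D (prec \<alpha>)"
    and succ_bilinear: "\<alpha> \<in> \<Omega> \<Longrightarrow> bilinear_operation K D (succ \<alpha>)"
    and prec_prec:
      "\<lbrakk>\<alpha> \<in> \<Omega>; \<beta> \<in> \<Omega>; x \<in> carrier D; y \<in> carrier D; z \<in> carrier D\<rbrakk> \<Longrightarrow>
        prec \<beta> (prec \<alpha> x y) z =
          prec \<alpha> x (prec \<beta> y z) \<oplus>\<^bsub>D\<^esub> prec \<beta> x (succ \<alpha> y z)"
    and succ_prec:
      "\<lbrakk>\<alpha> \<in> \<Omega>; \<beta> \<in> \<Omega>; x \<in> carrier D; y \<in> carrier D; z \<in> carrier D\<rbrakk> \<Longrightarrow>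
        prec \<beta> (succ \<alpha> x y) z = succ \<alpha> x (prec \<beta> y z)"
    and succ_succ:
      "\<lbrakk>\<alpha> \<in> \<Omega>; \<beta> \<in> \<Omega>; x \<in> carrier D; y \<in> carrier D; z \<in> carrier D\<rbrakk> \<Longrightarrow>
        succ \<alpha> (prec \<beta> x y) z \<oplus>\<^bsub>D\<^esub> succ \<beta> (succ \<alpha> x y) z =
          succ \<alpha> x (succ \<beta> y z)"

locale matching_pre_Lie_algebra = module K A
  for K :: "('k, 'r) ring_scheme" and A :: "('k, 'm, 'd) module_scheme" +
  fixes \<Omega> :: "'w set"
    and star :: "'w \<Rightarrow> 'm \<Rightarrow> 'm \<Rightarrow> 'm"
  assumes star_bilinear: "\<alpha> \<in> \<Omega> \<Longrightarrow> bilinear_operation K A (star \<alpha>)"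
    and pre_Lie:
      "\<lbrakk>\<alpha> \<in> \<Omega>; \<beta> \<in> \<Omega>; x \<in> carrier A; y \<in> carrier A; z \<in> carrier A\<rbrakk> \<Longrightarrow>
        star \<alpha> x (star \<beta> y z) \<ominus>\<^bsub>A\<^esub> star \<beta> (star \<alpha> x y) z =
          star \<beta> y (star \<alpha> x z) \<ominus>\<^bsub>A\<^esub> star \<alpha> (star \<beta> y x) z"

end

theory Submission
  imports Defs
begin

text \<open>
  For every \<open>x, y, z\<close> the dendriform axioms turn the associator
  \<open>x *\<^sub>\<alpha> (y *\<^sub>\<beta> z) - (x *\<^sub>\<alpha> y) *\<^sub>\<beta> z\<close> into
  \<open>(x \<prec>\<^sub>\<beta> y) \<succ>\<^sub>\<alpha> z + (y \<prec>\<^sub>\<alpha> x) \<succ>\<^sub>\<beta> z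
    - (x \<succ>\<^sub>\<alpha> (z \<prec>\<^sub>\<beta> y) + y \<succ>\<^sub>\<beta> (z \<prec>\<^sub>\<alpha> x))
    + (z \<prec>\<^sub>\<alpha> (y \<succ>\<^sub>\<beta> x) + z \<prec>\<^sub>\<beta> (x \<succ>\<^sub>\<alpha> y))\<close>,
  which is visibly invariant under exchanging \<open>(x, \<alpha>)\<close> and \<open>(y, \<beta>)\<close>.
\<close>

lemma bilinear_operation_closed:
  assumes "bilinear_operation K M f" "x \<in> carrier M" "y \<in> carrier M"
  shows "f x y \<in> carrier M"
  using assms by (auto simp: bilinear_operation_def Pi_iff)

context module
begin

text \<open>Used twice: it carries facts about the left argument over to the right one, and it
  covers the swapped term \<open>prec \<omega> y x\<close> of \<open>star\<close>.\<close>

lemma bilinear_operation_flip: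
  assumes "bilinear_operation R M f"
  shows "bilinear_operation R M (\<lambda>x y. f y x)"
  using assms by (auto simp: bilinear_operation_def Pi_iff)

lemma bilinear_operation_minus_left:
  assumes f: "bilinear_operation R M f"
    and x: "x \<in> carrier M" and y: "y \<in> carrier M" and z: "z \<in> carrier M"
  shows "f (x \<ominus>\<^bsub>M\<^esub> y) z = f x z \<ominus>\<^bsub>M\<^esub> f y z"
proof -
  note closed = bilinear_operation_closed[OF f]
  have d: "x \<ominus>\<^bsub>M\<^esub> y \<in> carrier M" using x y by simp
  \<comment> \<open>Additivity speaks of sums only, so it is applied to x = (x - y) + y and
    \<open>f y z\<close> is then subtracted.\<close>
  have "x \<ominus>\<^bsub>M\<^esub> y \<oplus>\<^bsub>M\<^esub> y = x"
    using x y by (simp add: M.minus_eq M.a_assoc M.l_neg)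
  then have "f x z = f (x \<ominus>\<^bsub>M\<^esub> y) z \<oplus>\<^bsub>M\<^esub> f y z"
    using f d y z unfolding bilinear_operation_def by metis
  then show ?thesis
    using closed[OF d z] closed[OF y z] by (simp add: M.minus_eq M.a_assoc M.r_neg)
qed

lemma bilinear_operation_minus_right:
  assumes "bilinear_operation R M f"
    and "x \<in> carrier M" and "y \<in> carrier M" and "z \<in> carrier M"
  shows "f x (y \<ominus>\<^bsub>M\<^esub> z) = f x y \<ominus>\<^bsub>M\<^esub> f x z"
  by (rule bilinear_operation_minus_left[OF bilinear_operation_flip[OF assms(1)] assms(3,4,2)])

lemma bilinear_operation_diff:
  assumes f: "bilinear_operation R M f" and g: "bilinear_operation R M g"
  shows "bilinear_operation R M (\<lambda>x y. f x y \<ominus>\<^bsub>M\<^esub> g x y)"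
  using f g bilinear_operation_closed[OF f] bilinear_operation_closed[OF g]
  by (simp add: bilinear_operation_def Pi_iff M.minus_eq M.minus_add M.a_ac
      smult_r_distr smult_r_minus)

end

context matching_dendriform_algebra
begin

definition star :: "'w \<Rightarrow> 'm \<Rightarrow> 'm \<Rightarrow> 'm" where
  "star \<omega> x y = succ \<omega> x y \<ominus>\<^bsub>D\<^esub> prec \<omega> y x"

lemma star_bilinear:
  assumes "\<alpha> \<in> \<Omega>"
  shows "bilinear_operation K D (star \<alpha>)"
  unfolding star_def
  using bilinear_operation_diff[OF succ_bilinear bilinear_operation_flip[OF prec_bilinear]] assms
  by blast

lemma star_associator:
  assumes [simp]: "\<alpha> \<in> \<Omega>" "\<beta> \<in> \<Omega>" "x \<in> carrier D" "y \<in> carrier D" "z \<in> carrier D"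
  shows "star \<alpha> x (star \<beta> y z) \<ominus>\<^bsub>D\<^esub> star \<beta> (star \<alpha> x y) z =
    (succ \<alpha> (prec \<beta> x y) z \<oplus>\<^bsub>D\<^esub> succ \<beta> (prec \<alpha> y x) z)
    \<ominus>\<^bsub>D\<^esub> (succ \<alpha> x (prec \<beta> z y) \<oplus>\<^bsub>D\<^esub> succ \<beta> y (prec \<alpha> z x))
    \<oplus>\<^bsub>D\<^esub> (prec \<alpha> z (succ \<beta> y x) \<oplus>\<^bsub>D\<^esub> prec \<beta> z (succ \<alpha> x y))"
proof -
  note [simp] = bilinear_operation_closed[OF prec_bilinear] bilinear_operation_closed[OF succ_bilinear]
  \<comment> \<open>The associator after expansion: \<open>q\<close> is
    \<open>succ \<beta> (succ \<alpha> x y) z\<close> and \<open>t\<close> is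
    \<open>prec \<beta> z (prec \<alpha> y x)\<close>. Both of its halves contain these two terms,
    which therefore drop out.\<close>
  have cancel: "((p \<oplus>\<^bsub>D\<^esub> q) \<ominus>\<^bsub>D\<^esub> b) \<ominus>\<^bsub>D\<^esub> (c \<ominus>\<^bsub>D\<^esub> (t \<oplus>\<^bsub>D\<^esub> u))
      \<ominus>\<^bsub>D\<^esub> ((q \<ominus>\<^bsub>D\<^esub> p') \<ominus>\<^bsub>D\<^esub> (v \<ominus>\<^bsub>D\<^esub> t))
      = (p \<oplus>\<^bsub>D\<^esub> p') \<ominus>\<^bsub>D\<^esub> (b \<oplus>\<^bsub>D\<^esub> c) \<oplus>\<^bsub>D\<^esub> (u \<oplus>\<^bsub>D\<^esub> v)"
    if [simp]: "p \<in> carrier D" "q \<in> carrier D" "b \<in> carrier D" "c \<in> carrier D" "t \<in> carrier D"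
      "u \<in> carrier D" "p' \<in> carrier D" "v \<in> carrier D" for p q b c t u p' v
  proof -
    \<comment> \<open>The inverse laws stay off here, so that both sides keep \<open>q\<close>,
      \<open>t\<close> and their negatives and AC rewriting yields the same sum.\<close>
    have "((p \<oplus>\<^bsub>D\<^esub> q) \<ominus>\<^bsub>D\<^esub> b) \<ominus>\<^bsub>D\<^esub> (c \<ominus>\<^bsub>D\<^esub> (t \<oplus>\<^bsub>D\<^esub> u))
        \<ominus>\<^bsub>D\<^esub> ((q \<ominus>\<^bsub>D\<^esub> p') \<ominus>\<^bsub>D\<^esub> (v \<ominus>\<^bsub>D\<^esub> t))
      = (q \<oplus>\<^bsub>D\<^esub> \<ominus>\<^bsub>D\<^esub> q) \<oplus>\<^bsub>D\<^esub> ((t \<oplus>\<^bsub>D\<^esub> \<ominus>\<^bsub>D\<^esub> t)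
        \<oplus>\<^bsub>D\<^esub> ((p \<oplus>\<^bsub>D\<^esub> p') \<ominus>\<^bsub>D\<^esub> (b \<oplus>\<^bsub>D\<^esub> c) \<oplus>\<^bsub>D\<^esub> (u \<oplus>\<^bsub>D\<^esub> v)))"
      by (simp add: M.minus_eq M.minus_add M.a_ac del: M.r_neg M.l_neg M.add.r_inv M.add.l_inv)
    then show ?thesis by (simp add: M.r_neg)
  qed
  show ?thesis
    \<comment> \<open>\<open>succ_succ\<close> is read from right to left, so that
      \<open>succ \<alpha> x (succ \<beta> y z)\<close> splits into \<open>p\<close> and
      \<open>q\<close> as \<open>cancel\<close> expects.\<close>
    by (simp add: star_def bilinear_operation_minus_left[OF prec_bilinear]
        bilinear_operation_minus_left[OF succ_bilinear]
        bilinear_operation_minus_right[OF prec_bilinear]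
        bilinear_operation_minus_right[OF succ_bilinear]
        prec_prec succ_prec cancel flip: succ_succ)
qed

lemma matching_pre_Lie_algebra_star: "matching_pre_Lie_algebra K D \<Omega> star"
proof unfold_locales
  fix \<alpha> \<beta> x y z
  assume "\<alpha> \<in> \<Omega>" "\<beta> \<in> \<Omega>" "x \<in> carrier D" "y \<in> carrier D" "z \<in> carrier D"
  \<comment> \<open>The exchange only swaps the two summands in each of the three brackets of
    \<open>star_associator\<close>.\<close>
  then show "star \<alpha> x (star \<beta> y z) \<ominus>\<^bsub>D\<^esub> star \<beta> (star \<alpha> x y) z =
      star \<beta> y (star \<alpha> x z) \<ominus>\<^bsub>D\<^esub> star \<alpha> (star \<beta> y x) z"
    by (simp add: star_associator M.a_comm bilinear_operation_closed[OF prec_bilinear]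
        bilinear_operation_closed[OF succ_bilinear])
qed (rule star_bilinear)

end

theorem theorem4p4:
  fixes K :: "('k, 'r) ring_scheme"
    and R :: "('k, 'm, 'd) module_scheme"
    and \<Omega> :: "'w set"
    and prec succ :: "'w \<Rightarrow> 'm \<Rightarrow> 'm \<Rightarrow> 'm"
  assumes "cring K"
    and "\<Omega> \<noteq> {}"
    and "matching_dendriform_algebra K R \<Omega> prec succ"
  shows "matching_pre_Lie_algebra K R \<Omega> (\<lambda>\<omega> x y. succ \<omega> x y \<ominus>\<^bsub>R\<^esub> prec \<omega> y x)"
proof -
  interpret matching_dendriform_algebra K R \<Omega> prec succ by fact
  show ?thesis using matching_pre_Lie_algebra_star unfolding star_def .
qed

end
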